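(* Let $\mathcal{I}=\{I\times\mathbb{R};W_1,W_2,\dots,W_{N-1}\}$ be the iterated function system associated with the data $(f,\Delta,b,\alpha)$, let $f^{\alpha}$ be the corresponding $\alpha$-fractal function, and write $\mathrm{Graph}(f^{\alpha})=\{(x,f^{\alpha}(x)):x\in I\}$. Suppose that for every $i\in\{1,2,\dots,N-1\}$ there are real numbers $0<r_i\le R_i<1$ such that $$ r_i\,\|(x,y)-(w,z)\|_2\le \|W_i(x,y)-W_i(w,z)\|_2\le R_i\,\|(x,y)-(w,z)\|_2$$ for every $(x,y),(w,z)\in I\times\mathbb{R}$. Then $$ s_*\le \dim_H(\mathrm{Graph}(f^{\alpha}))\le s^*,$$ where $s_*$ and $s^*$ are determined by $\sum_{i=1}^{N-1} r_i^{s_*}=1$ and $\sum_{i=1}^{N-1}R_i^{s^*}=1$ respectively.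
   Context: Let $\Delta=\{x_1<x_2<\dots<x_N\}$ be a partition of $I=[x_1,x_N]\subset\mathbb{R}$, $J=\{1,\dots,N-1\}$, $I_j=[x_j,x_{j+1}]$ for $j\in J$. For $j\in J$ let $L_j:I\to I_j$, $L_j(x)=a_jx+b_j$, be the affine contraction homeomorphism with $L_j(x_1)=x_j$, $L_j(x_N)=x_{j+1}$. Let $f:I\to\mathbb{R}$ be continuous (germ function); let $b:I\to\mathbb{R}$ be continuous with $b(x_1)=f(x_1)$, $b(x_N)=f(x_N)$, $b\neq f$ (base function); let $\alpha=(\alpha_1,\dots,\alpha_{N-1})$ with each $\alpha_j:I\to\mathbb{R}$ continuous and $\|\alpha\|_\infty:=\max_{j\in J}\|\alpha_j\|_\infty<1$ (scaling functions), where $\|\cdot\|_\infty$ is the sup norm on $I$. For $j\in J$ define $W_j:I\times\mathbb{R}\to I\times\mathbb{R}$ by $$W_j(x,y)=\big(L_j(x),\ \alpha_j(x)y+f(L_j(x))-\alpha_j(x)b(x)\big).$$ The IFS $\{I\times\mathbb{R};W_1,\dots,W_{N-1}\}$ has as attractor the graph of a continuous function $f^\alpha:I\to\mathbb{R}$, called the $\alpha$-fractal function corresponding to $f$ with respect to $\Delta$ and $b$; it is the unique continuous function satisfying $$f^{\alpha}(x)=f(x)+\alpha_j(L_j^{-1}(x))\,(f^{\alpha}-b)(L_j^{-1}(x))\quad\text{for all }x\in I_j,\ j\in J.$$ $\dim_H$ denotes Hausdorff dimension and $\|\cdot\|_2$ the Euclidean norm on $\mathbb{R}^2$. *)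

theory Defs
  imports "HOL-Analysis.Analysis"
begin

section \<open>Hausdorff measure and dimension\<close>

text \<open>The power \<open>diam(U)^s\<close> with the conventions that the empty set contributes \<open>0\<close> and every
  nonempty set contributes \<open>1\<close> for \<open>s = 0\<close> (note that \<open>0 powr 0 = 0\<close>).\<close>

definition diam_pow :: "real \<Rightarrow> 'a::metric_space set \<Rightarrow> real" where
  "diam_pow s U = (if U = {} then 0 else if s = 0 then 1 else diameter U powr s)"

text \<open>Boundedness is required explicitly because \<open>diameter\<close> is only meaningful on bounded sets.\<close>

definition delta_covers :: "real \<Rightarrow> 'a::metric_space set \<Rightarrow> (nat \<Rightarrow> 'a set) set" where
  "delta_covers \<delta> A =
     {U. A \<subseteq> (\<Union>i. U i) \<and> (\<forall>i. bounded (U i) \<and> diameter (U i) \<le> \<delta>)}"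

definition hausdorff_pre_measure :: "real \<Rightarrow> real \<Rightarrow> 'a::metric_space set \<Rightarrow> ennreal" where
  "hausdorff_pre_measure s \<delta> A = (INF U\<in>delta_covers \<delta> A. \<Sum>i. ennreal (diam_pow s (U i)))"

definition hausdorff_measure :: "real \<Rightarrow> 'a::metric_space set \<Rightarrow> ennreal" where
  "hausdorff_measure s A = (SUP \<delta>\<in>{0<..}. hausdorff_pre_measure s \<delta> A)"

definition hausdorff_dim :: "'a::metric_space set \<Rightarrow> ereal" where
  "hausdorff_dim A = Inf {ereal s | s. 0 \<le> s \<and> hausdorff_measure s A = 0}"


section \<open>Fractal functions\<close>

text \<open>The partition is \<open>x 1 < \<dots> < x N\<close>; the values of \<open>x\<close> outside \<open>{1..N}\<close> and those of the
  function data outside \<open>{x 1..x N}\<close> are irrelevant.\<close>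

definition L_map :: "nat \<Rightarrow> (nat \<Rightarrow> real) \<Rightarrow> nat \<Rightarrow> real \<Rightarrow> real" where
  "L_map N x j t =
     (x (j + 1) - x j) / (x N - x 1) * t + (x N * x j - x 1 * x (j + 1)) / (x N - x 1)"

lemma L_map_endpoints:
  assumes "x 1 < x N"
  shows "L_map N x j (x 1) = x j" "L_map N x j (x N) = x (j + 1)"
proof -
  have "L_map N x j t = ((x (j + 1) - x j) * t + (x N * x j - x 1 * x (j + 1))) / (x N - x 1)" for t
    by (simp add: L_map_def add_divide_distrib)
  moreover have "x N - x 1 \<noteq> 0"
    using assms by simp
  ultimately show "L_map N x j (x 1) = x j" "L_map N x j (x N) = x (j + 1)"
    by (simp_all add: nonzero_divide_eq_eq) (simp_all add: algebra_simps)
qed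

text \<open>Only \<open>N \<ge> 2\<close> is required, so that the interval is nondegenerate. The maps \<open>L_map N x j\<close> are
  contractions iff \<open>N \<ge> 3\<close>; for \<open>N = 2\<close> the single map is the identity.\<close>

definition fractal_data ::
  "nat \<Rightarrow> (nat \<Rightarrow> real) \<Rightarrow> (real \<Rightarrow> real) \<Rightarrow> (real \<Rightarrow> real) \<Rightarrow> (nat \<Rightarrow> real \<Rightarrow> real) \<Rightarrow> bool" where
  "fractal_data N x f b \<alpha> \<longleftrightarrow>
     2 \<le> N \<and> strict_mono_on {1..N} x \<and>
     continuous_on {x 1..x N} f \<and>
     continuous_on {x 1..x N} b \<and>
     b (x 1) = f (x 1) \<and> b (x N) = f (x N) \<and> (\<exists>t\<in>{x 1..x N}. b t \<noteq> f t) \<and>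
     (\<forall>j\<in>{1..<N}. continuous_on {x 1..x N} (\<alpha> j)) \<and>
     (MAX j\<in>{1..<N}. SUP t\<in>{x 1..x N}. \<bar>\<alpha> j t\<bar>) < 1"

definition W_map ::
  "nat \<Rightarrow> (nat \<Rightarrow> real) \<Rightarrow> (real \<Rightarrow> real) \<Rightarrow> (real \<Rightarrow> real) \<Rightarrow> (nat \<Rightarrow> real \<Rightarrow> real) \<Rightarrow>
     nat \<Rightarrow> real \<times> real \<Rightarrow> real \<times> real" where
  "W_map N x f b \<alpha> j = (\<lambda>(t, y). (L_map N x j t, \<alpha> j t * y + f (L_map N x j t) - \<alpha> j t * b t))"

text \<open>For valid data these conditions determine \<open>g\<close> uniquely on \<open>{x 1..x N}\<close>.\<close>

definition is_fractal_function ::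
  "nat \<Rightarrow> (nat \<Rightarrow> real) \<Rightarrow> (real \<Rightarrow> real) \<Rightarrow> (real \<Rightarrow> real) \<Rightarrow> (nat \<Rightarrow> real \<Rightarrow> real) \<Rightarrow>
     (real \<Rightarrow> real) \<Rightarrow> bool" where
  "is_fractal_function N x f b \<alpha> g \<longleftrightarrow>
     continuous_on {x 1..x N} g \<and>
     (\<forall>j\<in>{1..<N}. \<forall>t\<in>{x j..x (j + 1)}.
        let u = inv_into {x 1..x N} (L_map N x j) t
        in g t = f t + \<alpha> j u * (g u - b u))"

definition graph_on :: "real set \<Rightarrow> (real \<Rightarrow> real) \<Rightarrow> (real \<times> real) set" where
  "graph_on I g = {(t, g t) | t. t \<in> I}"

end

theory Submission
  imports Defs
begin

text \<open>The functional equation of the fractal function says that its graph \<open>E\<close> is invariant under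
  the maps \<open>W\<^sub>i\<close>: it is the union of the pieces \<open>W\<^sub>i(E)\<close>, where \<open>W\<^sub>i\<close> carries the point over \<open>t\<close> to the
  point over \<open>L\<^sub>i(t)\<close>. Everything else is about a compact set that is invariant under finitely many
  maps of a metric space.

  Upper bound (\<open>hausdorff_dim_le_of_contractions\<close>). The images \<open>W\<^sub>u(E)\<close> over all words \<open>u\<close> of length
  \<open>n\<close> cover \<open>E\<close>, have diameter at most \<open>R\<^sub>u diam(E)\<close> with \<open>R\<^sub>u\<close> the product of the ratios along \<open>u\<close>, and
  the sum of their \<open>s\<close>-th powers is at most \<open>(\<Sum>i. R\<^sub>i\<^sup>s)\<^sup>n diam(E)\<^sup>s\<close>. For \<open>s\<close> above the upper exponent this
  tends to \<open>0\<close>.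

  Lower bound (\<open>hausdorff_dim_ge_of_strong_separation\<close>). If the images of \<open>E\<close> under finitely many maps
  are at mutual distance at least \<open>\<delta>\<close>, a set of diameter below \<open>\<delta>\<close> meets only one of them, so
  a finite cover of \<open>E\<close> by such sets splits into smaller covers of the single images, which can be
  pulled back to \<open>E\<close>. Induction on the size of the cover gives a positive lower bound for the sum of
  the \<open>s\<close>-th powers of the diameters (\<open>separated_cover_sum_ge\<close>); no measure on \<open>E\<close> has to be built.
  Compactness extends the bound to countable covers.

  Neighbouring pieces \<open>W\<^sub>i(E)\<close> of the graph meet in an endpoint, so that the system itself is not
  separated. But for the word \<open>w = [1, 2]\<close> the set \<open>W\<^sub>w(E)\<close> avoids both endpoints of the graph, and
  hence the sets \<open>W\<^sub>u(W\<^sub>w(E))\<close>, with \<open>u\<close> ranging over the words of a fixed length \<open>n\<close>, are compact and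
  pairwise disjoint. Appending \<open>w\<close> to each \<open>u\<close> costs only the constant factor \<open>r\<^sub>w\<^sup>s\<close> in the sum of the powers
  of the ratios, which becomes \<open>r\<^sub>w\<^sup>s (\<Sum>i. r\<^sub>i\<^sup>s)\<^sup>n\<close>. For \<open>s\<close> below the lower exponent the base
  exceeds \<open>1\<close>, so the factor is absorbed by taking \<open>n\<close> large.\<close>

section \<open>Hausdorff measure and finite covers\<close>

lemma diam_pow_nonneg: "0 \<le> diam_pow s U"
  by (simp add: diam_pow_def)

lemma powr_diameter_le_diam_pow: "diameter U powr s \<le> diam_pow s U"
  by (auto simp: diam_pow_def diameter_def)

lemma hausdorff_pre_measure_le_finite_cover:
  fixes U :: "'k \<Rightarrow> 'a::metric_space set"
  assumes "finite K" and "E \<subseteq> (\<Union>k\<in>K. U k)" and "0 \<le> \<delta>"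
    and "\<And>k. k \<in> K \<Longrightarrow> bounded (U k) \<and> diameter (U k) \<le> \<delta>"
  shows "hausdorff_pre_measure s \<delta> E \<le> ennreal (\<Sum>k\<in>K. diam_pow s (U k))"
proof -
  obtain h where h: "bij_betw h {0..<card K} K"
    using ex_bij_betw_nat_finite[OF \<open>finite K\<close>] by blast
  define V where "V i = (if i < card K then U (h i) else {})" for i
  have hK: "h i \<in> K" if "i < card K" for i
    using h that by (auto simp: bij_betw_def)
  have "E \<subseteq> (\<Union>i. V i)"
  proof
    fix p assume "p \<in> E"
    then obtain k where "k \<in> K" "p \<in> U k" using assms(2) by blast
    moreover obtain i where "i < card K" "h i = k"
      using h \<open>k \<in> K\<close> by (metis atLeastLessThan_iff bij_betw_def imageE)
    ultimately show "p \<in> (\<Union>i. V i)" by (auto simp: V_def)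
  qed
  moreover have "bounded (V i) \<and> diameter (V i) \<le> \<delta>" for i
    using assms(3,4) hK by (auto simp: V_def)
  ultimately have "V \<in> delta_covers \<delta> E" by (auto simp: delta_covers_def)
  then have "hausdorff_pre_measure s \<delta> E \<le> (\<Sum>i. ennreal (diam_pow s (V i)))"
    unfolding hausdorff_pre_measure_def by (rule INF_lower)
  also have "\<dots> = (\<Sum>i\<in>{0..<card K}. ennreal (diam_pow s (V i)))"
    by (rule suminf_finite) (auto simp: V_def diam_pow_def)
  also have "\<dots> = (\<Sum>i\<in>{0..<card K}. ennreal (diam_pow s (U (h i))))"
    by (simp add: V_def)
  also have "\<dots> = (\<Sum>k\<in>K. ennreal (diam_pow s (U k)))"
    by (rule sum.reindex_bij_betw[OF h])
  also have "\<dots> = ennreal (\<Sum>k\<in>K. diam_pow s (U k))"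
    by (simp add: diam_pow_nonneg)
  finally show ?thesis .
qed

lemma diameter_le_of_dist_le:
  fixes U :: "'a::metric_space set"
  assumes "0 \<le> d" and "\<And>p q. p \<in> U \<Longrightarrow> q \<in> U \<Longrightarrow> dist p q \<le> d"
  shows "diameter U \<le> d"
  using assms by (auto simp: diameter_def intro: cSUP_least)

text \<open>Pulling a cover back along an expanding map \<open>h\<close> rescales the diameters by at most \<open>1 / c\<close>.\<close>

lemma diameter_mult_le:
  fixes U :: "'a::metric_space set" and U' :: "'b::metric_space set"
  assumes "bounded U'" and "0 < c"
    and "\<And>p. p \<in> U \<Longrightarrow> h p \<in> U'"
    and "\<And>p q. p \<in> U \<Longrightarrow> q \<in> U \<Longrightarrow> c * dist p q \<le> dist (h p) (h q)"
  shows "bounded U \<and> c * diameter U \<le> diameter U'"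
proof -
  have d: "dist p q \<le> diameter U' / c" if "p \<in> U" "q \<in> U" for p q
  proof -
    have "c * dist p q \<le> diameter U'"
      using assms(4)[OF that] diameter_bounded_bound[OF assms(1) assms(3)[OF that(1)] assms(3)[OF that(2)]]
      by linarith
    then show ?thesis using \<open>0 < c\<close> by (simp add: field_simps)
  qed
  have "bounded U"
    unfolding bounded_two_points using d by blast
  moreover have "diameter U \<le> diameter U' / c"
    by (rule diameter_le_of_dist_le) (use d diameter_ge_0[OF assms(1)] \<open>0 < c\<close> in auto)
  ultimately show ?thesis using \<open>0 < c\<close> by (simp add: field_simps)
qed

text \<open>The map \<open>\<eta> \<mapsto> (diam(U) + 2\<eta>)\<^sup>s\<close> is right continuous at \<open>0\<close> when \<open>s > 0\<close>, so a small enough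
  \<open>\<eta>\<close>-neighbourhood of \<open>U\<close> works. For \<open>s = 0\<close> continuity fails if \<open>U\<close> is a point, and it is the convention
  that nonempty sets contribute \<open>1\<close> which saves the estimate; hence the two sides use
  different powers.\<close>

lemma powr_diameter_neighbourhood:
  fixes U :: "'a::metric_space set"
  assumes "bounded U" and "0 \<le> s" and "0 < \<epsilon>"
  shows "\<exists>V. open V \<and> U \<subseteq> V \<and> bounded V \<and> diameter V powr s \<le> diam_pow s U + \<epsilon>"
proof (cases "U = {}")
  case True
  then show ?thesis using assms by (intro exI[of _ "{}"]) (simp add: diam_pow_def)
next
  case False
  define d where "d = diameter U"
  have "0 \<le> d" using assms by (simp add: d_def diameter_ge_0)
  have "\<exists>\<eta>>0. (d + 2 * \<eta>) powr s \<le> diam_pow s U + \<epsilon>"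
  proof (cases "s = 0")
    case True
    then show ?thesis using False assms
      by (intro exI[of _ 1]) (use \<open>0 \<le> d\<close> in \<open>auto simp: diam_pow_def\<close>)
  next
    case s: False
    have "((\<lambda>\<eta>. (d + 2 * \<eta>) powr s) \<longlongrightarrow> (d + 2 * 0) powr s) (at_right 0)"
    proof (rule tendsto_powr2)
      show "((\<lambda>\<eta>. d + 2 * \<eta>) \<longlongrightarrow> d + 2 * 0) (at_right 0)" by (intro tendsto_intros)
      show "eventually (\<lambda>\<eta>. 0 \<le> d + 2 * \<eta>) (at_right 0)"
        using eventually_at_right_less by (rule eventually_mono) (use \<open>0 \<le> d\<close> in simp)
    qed (use s assms in auto)
    then have "eventually (\<lambda>\<eta>. (d + 2 * \<eta>) powr s < d powr s + \<epsilon>) (at_right 0)"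
      by (rule order_tendstoD) (use \<open>0 < \<epsilon>\<close> in simp)
    then have "eventually (\<lambda>\<eta>. 0 < \<eta> \<and> (d + 2 * \<eta>) powr s < d powr s + \<epsilon>) (at_right 0)"
      using eventually_at_right_less by (rule eventually_elim2) simp
    then obtain \<eta> where "0 < \<eta>" "(d + 2 * \<eta>) powr s < d powr s + \<epsilon>"
      using eventually_happens trivial_limit_at_right_real by blast
    then show ?thesis
      using powr_diameter_le_diam_pow[of U s] by (intro exI[of _ \<eta>]) (auto simp: d_def)
  qed
  then obtain \<eta> where \<eta>: "\<eta> > 0" "(d + 2 * \<eta>) powr s \<le> diam_pow s U + \<epsilon>" by blast
  define V where "V = (\<Union>p\<in>U. ball p \<eta>)"
  have d: "dist p q \<le> d + 2 * \<eta>" if "p \<in> V" "q \<in> V" for p q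
  proof -
    obtain p' q' where "p' \<in> U" "dist p' p < \<eta>" "q' \<in> U" "dist q' q < \<eta>"
      using \<open>p \<in> V\<close> \<open>q \<in> V\<close> by (auto simp: V_def)
    moreover have "dist p' q' \<le> d"
      unfolding d_def by (rule diameter_bounded_bound) (use assms calculation in auto)
    moreover have "dist p q \<le> dist p' p + dist p' q' + dist q' q"
      using dist_triangle[of p q p'] dist_triangle[of p' q q'] by (simp add: dist_commute)
    ultimately show ?thesis by linarith
  qed
  have "bounded V" unfolding bounded_two_points using d by blast
  moreover have "diameter V \<le> d + 2 * \<eta>"
    by (rule diameter_le_of_dist_le) (use d \<eta> \<open>0 \<le> d\<close> in auto)
  then have "diameter V powr s \<le> (d + 2 * \<eta>) powr s"
    by (rule powr_mono2[OF assms(2) diameter_ge_0[OF \<open>bounded V\<close>]])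
  moreover have "open V" "U \<subseteq> V" using \<eta> by (auto simp: V_def)
  ultimately show ?thesis using \<eta> by (intro exI[of _ V]) auto
qed

text \<open>This is where compactness enters: the members of a countable cover of small weight are
  enlarged to open sets, at a total cost bounded by a geometric series, and a finite subcover is
  selected.\<close>

lemma finite_covers_of_null_compact:
  fixes E :: "'a::metric_space set"
  assumes "compact E" and "0 \<le> s" and "hausdorff_measure s E = 0" and "0 < c"
  obtains I :: "nat set" and U where "finite I" and "E \<subseteq> (\<Union>i\<in>I. U i)"
    and "\<And>i. i \<in> I \<Longrightarrow> bounded (U i)" and "(\<Sum>i\<in>I. diameter (U i) powr s) < c"
proof -
  have "hausdorff_pre_measure s 1 E \<le> hausdorff_measure s E"
    unfolding hausdorff_measure_def by (rule SUP_upper) simp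
  (* One third of c bounds the weight of the cover, one third the cost of enlarging it; the last
     third makes the inequality strict. *)
  then have "hausdorff_pre_measure s 1 E < ennreal (c / 3)" using assms by simp
  then obtain U where U: "U \<in> delta_covers 1 E" "(\<Sum>i. ennreal (diam_pow s (U i))) < ennreal (c / 3)"
    unfolding hausdorff_pre_measure_def INF_less_iff by blast
  have "\<exists>V. open V \<and> U i \<subseteq> V \<and> bounded V \<and> diameter V powr s \<le> diam_pow s (U i) + c / 3 * (1/2) ^ Suc i" for i
    by (rule powr_diameter_neighbourhood) (use U assms in \<open>auto simp: delta_covers_def\<close>)
  then obtain V where V: "\<And>i. open (V i)" "\<And>i. U i \<subseteq> V i" "\<And>i. bounded (V i)"
     "\<And>i. diameter (V i) powr s \<le> diam_pow s (U i) + c / 3 * (1/2) ^ Suc i" by metis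
  have "E \<subseteq> (\<Union>i\<in>UNIV. V i)" using U V(2) by (fastforce simp: delta_covers_def)
  then obtain I where I: "finite I" "E \<subseteq> (\<Union>i\<in>I. V i)"
    using compactE_image[OF \<open>compact E\<close>, of UNIV V] V(1) by metis
  have "ennreal (\<Sum>i\<in>I. diam_pow s (U i)) = (\<Sum>i\<in>I. ennreal (diam_pow s (U i)))"
    by (simp add: diam_pow_nonneg)
  also have "\<dots> \<le> (\<Sum>i. ennreal (diam_pow s (U i)))"
    by (rule sum_le_suminf) (use I in auto)
  also note U(2)
  finally have 1: "(\<Sum>i\<in>I. diam_pow s (U i)) < c / 3"
    using \<open>0 < c\<close> by (simp add: ennreal_less_iff sum_nonneg diam_pow_nonneg)
  have "(\<Sum>i\<in>I. (1/2::real) ^ Suc i) \<le> (\<Sum>i. (1/2) ^ Suc i)"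
    by (rule sum_le_suminf) (use I power_half_series in \<open>auto simp: sums_iff\<close>)
  also have "\<dots> = 1" using power_half_series by (simp add: sums_iff)
  finally have 2: "(\<Sum>i\<in>I. (1/2::real) ^ Suc i) \<le> 1" .
  have "(\<Sum>i\<in>I. diameter (V i) powr s) \<le> (\<Sum>i\<in>I. diam_pow s (U i) + c / 3 * (1/2) ^ Suc i)"
    by (rule sum_mono) (rule V(4))
  also have "\<dots> = (\<Sum>i\<in>I. diam_pow s (U i)) + c / 3 * (\<Sum>i\<in>I. (1/2) ^ Suc i)"
    by (simp add: sum.distrib sum_distrib_left)
  also have "\<dots> \<le> (\<Sum>i\<in>I. diam_pow s (U i)) + c / 3 * 1"
    using 2 \<open>0 < c\<close> by (intro add_left_mono mult_left_mono) auto
  also have "\<dots> < c" using 1 \<open>0 < c\<close> by linarith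
  finally show ?thesis using that[of I V] I V(3) by blast
qed

section \<open>Separated systems of maps\<close>

text \<open>This replaces the mass distribution principle. A member of diameter at least \<open>\<delta>\<close> settles
  the claim by itself. Otherwise the members meeting different images are different, and since there
  are at least two nonempty images, each image is covered by strictly fewer members. Pulled back by
  \<open>V k\<close> these cover \<open>E\<close>, so by induction they contribute at least \<open>\<rho>\<^sub>k\<^sup>s \<delta>\<^sup>s\<close>, and the contributions
  add up to at least \<open>\<delta>\<^sup>s\<close>.\<close>

lemma separated_cover_sum_ge:
  fixes E :: "'a::metric_space set" and V :: "'k \<Rightarrow> 'a \<Rightarrow> 'a" and U :: "'i \<Rightarrow> 'a set"
  assumes K: "finite K" "2 \<le> card K" and "E \<noteq> {}" and "0 \<le> s" and "0 < \<delta>"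
    and inv: "\<And>k p. k \<in> K \<Longrightarrow> p \<in> E \<Longrightarrow> V k p \<in> E"
    and pos: "\<And>k. k \<in> K \<Longrightarrow> 0 < \<rho> k"
    and expand: "\<And>k p q. k \<in> K \<Longrightarrow> p \<in> E \<Longrightarrow> q \<in> E \<Longrightarrow> \<rho> k * dist p q \<le> dist (V k p) (V k q)"
    and gap: "\<And>k l p q. k \<in> K \<Longrightarrow> l \<in> K \<Longrightarrow> k \<noteq> l \<Longrightarrow> p \<in> E \<Longrightarrow> q \<in> E \<Longrightarrow>
                \<delta> \<le> dist (V k p) (V l q)"
    and total: "1 \<le> (\<Sum>k\<in>K. \<rho> k powr s)"
    and I: "finite I" "E \<subseteq> (\<Union>i\<in>I. U i)" "\<And>i. i \<in> I \<Longrightarrow> bounded (U i)"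
  shows "\<delta> powr s \<le> (\<Sum>i\<in>I. diameter (U i) powr s)"
  using I
proof (induction I arbitrary: U rule: finite_psubset_induct)
  case (psubset I)
  show ?case
  proof (cases "\<exists>i\<in>I. \<delta> \<le> diameter (U i)")
    case True
    then obtain i where "i \<in> I" "\<delta> \<le> diameter (U i)" by blast
    then have "\<delta> powr s \<le> diameter (U i) powr s"
      using assms by (intro powr_mono2) auto
    also have "\<dots> \<le> (\<Sum>i\<in>I. diameter (U i) powr s)"
      by (rule member_le_sum) (use psubset \<open>i \<in> I\<close> in auto)
    finally show ?thesis .
  next
    case False
    define J where "J k = {i\<in>I. \<exists>p\<in>E. V k p \<in> U i}" for k
    have J_sub: "J k \<subseteq> I" for k by (auto simp: J_def)
    have J_fin: "finite (J k)" for k using J_sub psubset.hyps finite_subset by blast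
    have disj: "J k \<inter> J l = {}" if kl: "k \<in> K" "l \<in> K" "k \<noteq> l" for k l
    proof (rule ccontr)
      assume "J k \<inter> J l \<noteq> {}"
      then obtain i p q where "i \<in> I" "p \<in> E" "q \<in> E" "V k p \<in> U i" "V l q \<in> U i"
        by (auto simp: J_def)
      then have "dist (V k p) (V l q) \<le> diameter (U i)"
        using diameter_bounded_bound psubset.prems(2) by blast
      then show False using gap[OF kl \<open>p \<in> E\<close> \<open>q \<in> E\<close>] False \<open>i \<in> I\<close> by force
    qed
    have ne: "J k \<noteq> {}" if "k \<in> K" for k
    proof -
      obtain p where "p \<in> E" using \<open>E \<noteq> {}\<close> by blast
      then show ?thesis using inv[OF that] psubset.prems(1) unfolding J_def by fast
    qed
    have piece: "\<rho> k powr s * \<delta> powr s \<le> (\<Sum>i\<in>J k. diameter (U i) powr s)" if k: "k \<in> K" for k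
    proof -
      define U' where "U' i = {p\<in>E. V k p \<in> U i}" for i
      have U': "bounded (U' i) \<and> \<rho> k * diameter (U' i) \<le> diameter (U i)" if "i \<in> I" for i
        by (rule diameter_mult_le[where h = "V k"])
           (use psubset.prems(2)[OF that] pos[OF k] expand[OF k] in \<open>auto simp: U'_def\<close>)
      obtain l where "l \<in> K" "l \<noteq> k"
        using K k by (metis One_nat_def card_le_Suc0_iff_eq not_less_eq_eq numeral_2_eq_2)
      then have "J k \<subset> I" using disj[OF k, of l] ne[of l] J_sub[of k] J_sub[of l] by blast
      moreover have "E \<subseteq> (\<Union>i\<in>J k. U' i)"
      proof
        fix p assume "p \<in> E"
        then obtain i where "i \<in> I" "V k p \<in> U i" using inv[OF k] psubset.prems(1) by blast
        then show "p \<in> (\<Union>i\<in>J k. U' i)" using \<open>p \<in> E\<close> by (auto simp: J_def U'_def)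
      qed
      ultimately have "\<delta> powr s \<le> (\<Sum>i\<in>J k. diameter (U' i) powr s)"
        by (rule psubset.IH) (use U' J_sub in auto)
      then have "\<rho> k powr s * \<delta> powr s \<le> \<rho> k powr s * (\<Sum>i\<in>J k. diameter (U' i) powr s)"
        by (simp add: mult_left_mono)
      also have "\<dots> = (\<Sum>i\<in>J k. (\<rho> k * diameter (U' i)) powr s)"
        unfolding sum_distrib_left
        by (rule sum.cong) (use U' J_sub pos[OF k] in \<open>auto simp: powr_mult diameter_ge_0\<close>)
      also have "\<dots> \<le> (\<Sum>i\<in>J k. diameter (U i) powr s)"
      proof (rule sum_mono)
        fix i assume "i \<in> J k"
        then have "i \<in> I" using J_sub by blast
        then show "(\<rho> k * diameter (U' i)) powr s \<le> diameter (U i) powr s"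
          using U'[of i] pos[OF k] \<open>0 \<le> s\<close>
          by (intro powr_mono2) (auto intro!: mult_nonneg_nonneg simp: diameter_ge_0)
      qed
      finally show ?thesis .
    qed
    have "\<delta> powr s \<le> (\<Sum>k\<in>K. \<rho> k powr s) * \<delta> powr s"
      using mult_right_mono[OF total, of "\<delta> powr s"] by simp
    also have "\<dots> \<le> (\<Sum>k\<in>K. \<Sum>i\<in>J k. diameter (U i) powr s)"
      unfolding sum_distrib_right by (rule sum_mono) (rule piece)
    also have "\<dots> = (\<Sum>i\<in>(\<Union>k\<in>K. J k). diameter (U i) powr s)"
      by (rule sum.UNION_disjoint[symmetric]) (use K J_fin disj in auto)
    also have "\<dots> \<le> (\<Sum>i\<in>I. diameter (U i) powr s)"
      by (rule sum_mono2) (use psubset.hyps J_sub in auto)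
    finally show ?thesis .
  qed
qed

lemma disjoint_compacts_gap:
  fixes C :: "'k \<Rightarrow> 'a::metric_space set"
  assumes "finite K" and "\<And>k. k \<in> K \<Longrightarrow> compact (C k)"
    and "\<And>k l. k \<in> K \<Longrightarrow> l \<in> K \<Longrightarrow> k \<noteq> l \<Longrightarrow> C k \<inter> C l = {}"
  obtains \<delta> :: real where "0 < \<delta>"
    and "\<And>k l p q. k \<in> K \<Longrightarrow> l \<in> K \<Longrightarrow> k \<noteq> l \<Longrightarrow> p \<in> C k \<Longrightarrow> q \<in> C l \<Longrightarrow> \<delta> \<le> dist p q"
proof -
  define P where "P = {(k, l). k \<in> K \<and> l \<in> K \<and> k \<noteq> l}"
  have "finite P" by (rule finite_subset[of _ "K \<times> K"]) (use assms(1) in \<open>auto simp: P_def\<close>)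
  have "\<exists>d>0. \<forall>p\<in>C (fst z). \<forall>q\<in>C (snd z). d \<le> dist p q" if "z \<in> P" for z
  proof (cases "C (fst z) \<times> C (snd z) = {}")
    case True
    then show ?thesis by (intro exI[of _ 1]) auto
  next
    case False
    have "compact (C (fst z) \<times> C (snd z))"
      using that assms(2) by (intro compact_Times) (auto simp: P_def)
    moreover have "continuous_on (C (fst z) \<times> C (snd z)) (\<lambda>y. dist (fst y) (snd y))"
      by (intro continuous_intros)
    ultimately obtain y where "y \<in> C (fst z) \<times> C (snd z)"
        "\<forall>y'\<in>C (fst z) \<times> C (snd z). dist (fst y) (snd y) \<le> dist (fst y') (snd y')"
      using continuous_attains_inf[OF _ False] by blast
    then obtain p q where pq: "p \<in> C (fst z)" "q \<in> C (snd z)"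
        "\<forall>y\<in>C (fst z) \<times> C (snd z). dist p q \<le> dist (fst y) (snd y)"
      by (cases y) auto
    then have "0 < dist p q" using assms(3)[of "fst z" "snd z"] that by (auto simp: P_def)
    then show ?thesis using pq(3) by (intro exI[of _ "dist p q"]) auto
  qed
  then obtain d :: "'k \<times> 'k \<Rightarrow> real" where d: "\<And>z. z \<in> P \<Longrightarrow> 0 < d z"
    "\<And>z p q. z \<in> P \<Longrightarrow> p \<in> C (fst z) \<Longrightarrow> q \<in> C (snd z) \<Longrightarrow> d z \<le> dist p q" by metis
  \<comment> \<open>The value 1 only keeps the minimum meaningful when there is no pair of distinct indices.\<close>
  define \<delta> where "\<delta> = Min (insert 1 (d ` P))"
  have "0 < \<delta>" unfolding \<delta>_def using \<open>finite P\<close> d(1) by (subst Min_gr_iff) auto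
  moreover have "\<delta> \<le> dist p q" if "k \<in> K" "l \<in> K" "k \<noteq> l" "p \<in> C k" "q \<in> C l" for k l p q
  proof -
    have z: "(k, l) \<in> P" using that by (simp add: P_def)
    then have "\<delta> \<le> d (k, l)" unfolding \<delta>_def using \<open>finite P\<close> by (intro Min_le) auto
    also have "\<dots> \<le> dist p q" using d(2)[OF z] that by simp
    finally show ?thesis .
  qed
  ultimately show ?thesis using that by blast
qed

section \<open>Iterated function systems and words\<close>

text \<open>A word \<open>u = [i\<^sub>1, \<dots>, i\<^sub>n]\<close> acts by \<open>foldr T u\<close>, which is the composition \<open>T i\<^sub>1 \<circ> \<dots> \<circ> T i\<^sub>n\<close>: the
  last letter acts first, so that the first letter says in which piece \<open>T i\<^sub>1 (E)\<close> the image lies.\<close>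

definition words :: "'i set \<Rightarrow> nat \<Rightarrow> 'i list set" where
  "words A n = {u. set u \<subseteq> A \<and> length u = n}"

lemma words_0: "words A 0 = {[]}"
  by (auto simp: words_def)

lemma words_Suc: "words A (Suc n) = (\<lambda>(i, u). i # u) ` (A \<times> words A n)"
  by (auto simp: words_def length_Suc_conv image_iff)

lemma finite_words: "finite A \<Longrightarrow> finite (words A n)"
  unfolding words_def by (rule finite_lists_length_eq)

lemma sum_words:
  fixes g :: "'i \<Rightarrow> 'c::comm_semiring_1"
  shows "(\<Sum>u\<in>words A n. prod_list (map g u)) = (\<Sum>i\<in>A. g i) ^ n"
proof (induction n)
  case 0
  then show ?case by (simp add: words_0)
next
  case (Suc n)
  have "inj_on (\<lambda>(i, u). i # u) (A \<times> words A n)" by (auto simp: inj_on_def)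
  then have "(\<Sum>u\<in>words A (Suc n). prod_list (map g u))
      = (\<Sum>(i, u)\<in>A \<times> words A n. g i * prod_list (map g u))"
    unfolding words_Suc by (subst sum.reindex) (auto intro!: sum.cong)
  also have "\<dots> = (\<Sum>i\<in>A. g i) * (\<Sum>u\<in>words A n. prod_list (map g u))"
    by (simp add: sum_product sum.cartesian_product)
  finally show ?case using Suc by simp
qed

lemma prod_list_map_pos:
  fixes g :: "'i \<Rightarrow> real"
  assumes "\<And>i. i \<in> set u \<Longrightarrow> 0 < g i"
  shows "0 < prod_list (map g u)"
  using assms by (induction u) auto

lemma prod_list_map_powr:
  fixes g :: "'i \<Rightarrow> real"
  assumes "\<And>i. i \<in> set u \<Longrightarrow> 0 < g i"
  shows "prod_list (map g u) powr s = prod_list (map (\<lambda>i. g i powr s) u)"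
  using assms
proof (induction u)
  case (Cons i u)
  then show ?case using prod_list_map_pos[of u g] by (simp add: powr_mult less_imp_le)
qed simp

lemma sum_words_powr:
  fixes g :: "'i \<Rightarrow> real"
  assumes "\<And>i. i \<in> A \<Longrightarrow> 0 < g i"
  shows "(\<Sum>u\<in>words A n. prod_list (map g u) powr s) = (\<Sum>i\<in>A. g i powr s) ^ n"
  unfolding sum_words[symmetric]
  by (rule sum.cong) (use assms in \<open>auto simp: words_def intro!: prod_list_map_powr\<close>)

lemma foldr_maps_into:
  assumes "\<And>i p. i \<in> set u \<Longrightarrow> p \<in> E \<Longrightarrow> T i p \<in> E" and "p \<in> E"
  shows "foldr T u p \<in> E"
  using assms by (induction u) auto

lemma foldr_dist_ge:
  fixes T :: "'i \<Rightarrow> 'a::metric_space \<Rightarrow> 'a"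
  assumes "\<And>i p. i \<in> set u \<Longrightarrow> p \<in> E \<Longrightarrow> T i p \<in> E" and "\<And>i. i \<in> set u \<Longrightarrow> 0 < r i"
    and "\<And>i p q. i \<in> set u \<Longrightarrow> p \<in> E \<Longrightarrow> q \<in> E \<Longrightarrow> r i * dist p q \<le> dist (T i p) (T i q)"
    and "p \<in> E" "q \<in> E"
  shows "prod_list (map r u) * dist p q \<le> dist (foldr T u p) (foldr T u q)"
  using assms(1-3)
proof (induction u)
  case (Cons i u)
  have "prod_list (map r (i # u)) * dist p q = r i * (prod_list (map r u) * dist p q)" by simp
  also have "\<dots> \<le> r i * dist (foldr T u p) (foldr T u q)"
    by (rule mult_left_mono[OF Cons.IH]) (use Cons.prems in \<open>auto simp: less_imp_le\<close>)
  also have "\<dots> \<le> dist (foldr T (i # u) p) (foldr T (i # u) q)"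
    using Cons.prems assms(4,5) by (auto intro!: Cons.prems(3) foldr_maps_into)
  finally show ?case .
qed simp

lemma foldr_dist_le:
  fixes T :: "'i \<Rightarrow> 'a::metric_space \<Rightarrow> 'a"
  assumes "\<And>i p. i \<in> set u \<Longrightarrow> p \<in> E \<Longrightarrow> T i p \<in> E" and "\<And>i. i \<in> set u \<Longrightarrow> 0 < R i"
    and "\<And>i p q. i \<in> set u \<Longrightarrow> p \<in> E \<Longrightarrow> q \<in> E \<Longrightarrow> dist (T i p) (T i q) \<le> R i * dist p q"
    and "p \<in> E" "q \<in> E"
  shows "dist (foldr T u p) (foldr T u q) \<le> prod_list (map R u) * dist p q"
  using assms(1-3)
proof (induction u)
  case (Cons i u)
  have "dist (foldr T (i # u) p) (foldr T (i # u) q) \<le> R i * dist (foldr T u p) (foldr T u q)"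
    using Cons.prems assms(4,5) by (auto intro!: Cons.prems(3) foldr_maps_into)
  also have "\<dots> \<le> R i * (prod_list (map R u) * dist p q)"
    by (rule mult_left_mono[OF Cons.IH]) (use Cons.prems in \<open>auto simp: less_imp_le\<close>)
  finally show ?case by (simp add: mult.assoc)
qed simp

lemma foldr_continuous_on:
  fixes T :: "'i \<Rightarrow> 'a::topological_space \<Rightarrow> 'a"
  assumes "\<And>i p. i \<in> set u \<Longrightarrow> p \<in> E \<Longrightarrow> T i p \<in> E" and "\<And>i. i \<in> set u \<Longrightarrow> continuous_on E (T i)"
  shows "continuous_on E (foldr T u)"
  using assms
proof (induction u)
  case (Cons i u)
  have "continuous_on E (\<lambda>p. T i (foldr T u p))"
  proof (rule continuous_on_compose2[of E "T i"])
    show "foldr T u ` E \<subseteq> E" using foldr_maps_into[of u E T] Cons.prems(1) by auto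
  qed (use Cons in auto)
  then show ?case by (simp add: o_def)
qed (simp add: id_def)

lemma words_cover:
  assumes "E \<subseteq> (\<Union>i\<in>A. T i ` E)"
  shows "E \<subseteq> (\<Union>u\<in>words A n. foldr T u ` E)"
proof (induction n)
  case 0
  then show ?case by (auto simp: words_0)
next
  case (Suc n)
  show ?case
  proof
    fix p assume "p \<in> E"
    then obtain i q where "i \<in> A" "q \<in> E" "p = T i q" using assms by blast
    moreover obtain u q' where "u \<in> words A n" "q' \<in> E" "q = foldr T u q'" using Suc \<open>q \<in> E\<close> by blast
    ultimately show "p \<in> (\<Union>u\<in>words A (Suc n). foldr T u ` E)"
      by (intro UN_I[of "i # u"]) (auto simp: words_def)
  qed
qed

text \<open>At the first letter where the two words differ, the images lie in disjoint sets \<open>T i ` S\<close> and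
  \<open>T j ` S\<close>; the common prefix before it is cancelled by injectivity.\<close>

lemma words_images_disjoint:
  fixes T :: "'i \<Rightarrow> 'a \<Rightarrow> 'a"
  assumes inv: "\<And>i p. i \<in> A \<Longrightarrow> p \<in> S \<Longrightarrow> T i p \<in> S"
    and inj: "\<And>i. i \<in> A \<Longrightarrow> inj_on (T i) S"
    and disj: "\<And>i j. i \<in> A \<Longrightarrow> j \<in> A \<Longrightarrow> i \<noteq> j \<Longrightarrow> T i ` S \<inter> T j ` S = {}"
    and "u \<in> words A n" "v \<in> words A n" "p \<in> S" "q \<in> S" "foldr T u p = foldr T v q"
  shows "u = v"
  using assms(4,5,8)
proof (induction n arbitrary: u v)
  case 0
  then show ?case by (simp add: words_0)
next
  case (Suc n)
  obtain i u' j v' where uv: "u = i # u'" "v = j # v'" "i \<in> A" "j \<in> A"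
      "u' \<in> words A n" "v' \<in> words A n"
    using Suc.prems by (auto simp: words_Suc)
  have "foldr T u' p \<in> S" "foldr T v' q \<in> S"
    using uv(5,6) \<open>p \<in> S\<close> \<open>q \<in> S\<close> by (auto simp: words_def intro!: foldr_maps_into inv)
  moreover have "T i (foldr T u' p) = T j (foldr T v' q)" using Suc.prems uv by simp
  ultimately show ?case
    using disj[OF uv(3,4)] inj[OF uv(3)] Suc.IH[OF uv(5,6)] uv by (fastforce simp: inj_on_def)
qed

section \<open>Dimension bounds for iterated function systems\<close>

lemma hausdorff_measure_eq_0_of_contractions:
  fixes E :: "'a::metric_space set" and T :: "'i \<Rightarrow> 'a \<Rightarrow> 'a"
  assumes "bounded E" and A: "finite A" and "0 < s"
    and cover: "E \<subseteq> (\<Union>i\<in>A. T i ` E)"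
    and inv: "\<And>i p. i \<in> A \<Longrightarrow> p \<in> E \<Longrightarrow> T i p \<in> E"
    and R: "\<And>i. i \<in> A \<Longrightarrow> 0 < R i \<and> R i < 1"
    and contract: "\<And>i p q. i \<in> A \<Longrightarrow> p \<in> E \<Longrightarrow> q \<in> E \<Longrightarrow> dist (T i p) (T i q) \<le> R i * dist p q"
    and small: "(\<Sum>i\<in>A. R i powr s) < 1"
  shows "hausdorff_measure s E = 0"
proof -
  define D where "D = diameter E"
  define \<theta> where "\<theta> = (\<Sum>i\<in>A. R i powr s)"
  define M where "M = Max (insert 0 (R ` A))"
  have "0 \<le> D" using assms by (simp add: D_def diameter_ge_0)
  have M: "0 \<le> M" "M < 1" and RM: "\<And>i. i \<in> A \<Longrightarrow> R i \<le> M"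
    unfolding M_def using A R by (auto intro!: Max_ge)
  have \<theta>: "0 \<le> \<theta>" "\<theta> < 1" using small by (auto simp: \<theta>_def intro: sum_nonneg)
  have diam: "bounded (foldr T u ` E) \<and> diameter (foldr T u ` E) \<le> prod_list (map R u) * D"
    if "u \<in> words A n" for u n
  proof -
    have u: "set u \<subseteq> A" using that by (simp add: words_def)
    have pos: "0 < prod_list (map R u)" by (rule prod_list_map_pos) (use u R in blast)
    have d: "dist p q \<le> prod_list (map R u) * D" if pq_image: "p \<in> foldr T u ` E" "q \<in> foldr T u ` E" for p q
    proof -
      obtain p' q' where pq: "p' \<in> E" "q' \<in> E" "p = foldr T u p'" "q = foldr T u q'"
        using pq_image by blast
      have "dist p q \<le> prod_list (map R u) * dist p' q'"
        unfolding pq(3,4) by (rule foldr_dist_le[where E = E]) (use u R inv contract pq in auto)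
      also have "\<dots> \<le> prod_list (map R u) * D"
        unfolding D_def using pos assms(1) pq by (intro mult_left_mono diameter_bounded_bound) auto
      finally show ?thesis .
    qed
    have "bounded (foldr T u ` E)" unfolding bounded_two_points using d by blast
    moreover have "diameter (foldr T u ` E) \<le> prod_list (map R u) * D"
      by (rule diameter_le_of_dist_le) (use d pos \<open>0 \<le> D\<close> in auto)
    ultimately show ?thesis by blast
  qed
  have prod_le: "prod_list (map R u) \<le> M ^ n" if "u \<in> words A n" for u n
    using that
  proof (induction n arbitrary: u)
    case (Suc n)
    then obtain i v where v: "u = i # v" "i \<in> A" "v \<in> words A n" by (auto simp: words_Suc)
    have "0 \<le> prod_list (map R v)"
      by (rule less_imp_le, rule prod_list_map_pos) (use v R in \<open>auto simp: words_def\<close>)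
    then show ?case using Suc.IH[OF v(3)] RM[OF v(2)] M v by (auto intro!: mult_mono)
  qed (simp add: words_0)
  have pre: "hausdorff_pre_measure s \<delta> E \<le> ennreal \<epsilon>" if "0 < \<delta>" "0 < \<epsilon>" for \<delta> \<epsilon>
  proof -
    have "(\<lambda>n. M ^ n * D) \<longlonglongrightarrow> 0 * D" "(\<lambda>n. \<theta> ^ n * D powr s) \<longlonglongrightarrow> 0 * D powr s"
      using M \<theta> by (intro tendsto_mult LIMSEQ_power_zero tendsto_const; simp)+
    then have "eventually (\<lambda>n. M ^ n * D < \<delta>) sequentially"
        "eventually (\<lambda>n. \<theta> ^ n * D powr s < \<epsilon>) sequentially"
      using that by (auto intro: order_tendstoD)
    then have "eventually (\<lambda>n. M ^ n * D < \<delta> \<and> \<theta> ^ n * D powr s < \<epsilon>) sequentially"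
      by (rule eventually_conj)
    then obtain n where n: "M ^ n * D < \<delta>" "\<theta> ^ n * D powr s < \<epsilon>"
      using eventually_happens sequentially_bot by blast
    have "hausdorff_pre_measure s \<delta> E \<le> ennreal (\<Sum>u\<in>words A n. diam_pow s (foldr T u ` E))"
    proof (rule hausdorff_pre_measure_le_finite_cover)
      fix u assume u: "u \<in> words A n"
      have "prod_list (map R u) * D \<le> M ^ n * D"
        by (rule mult_right_mono[OF prod_le[OF u] \<open>0 \<le> D\<close>])
      then show "bounded (foldr T u ` E) \<and> diameter (foldr T u ` E) \<le> \<delta>"
        using diam[OF u] n(1) by linarith
    qed (use A finite_words words_cover[OF cover] that in auto)
    also have "\<dots> \<le> ennreal (\<Sum>u\<in>words A n. (prod_list (map R u) * D) powr s)"
    proof (intro ennreal_leI sum_mono)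
      fix u assume u: "u \<in> words A n"
      have "diam_pow s (foldr T u ` E) \<le> diameter (foldr T u ` E) powr s"
        using \<open>0 < s\<close> by (auto simp: diam_pow_def)
      also have "\<dots> \<le> (prod_list (map R u) * D) powr s"
        using diam[OF u] \<open>0 < s\<close> by (intro powr_mono2) (auto simp: diameter_ge_0)
      finally show "diam_pow s (foldr T u ` E) \<le> (prod_list (map R u) * D) powr s" .
    qed
    also have "(\<Sum>u\<in>words A n. (prod_list (map R u) * D) powr s)
        = (\<Sum>u\<in>words A n. prod_list (map R u) powr s) * D powr s"
      unfolding sum_distrib_right
    proof (rule sum.cong)
      fix u assume "u \<in> words A n"
      then have "0 < prod_list (map R u)" using R by (intro prod_list_map_pos) (auto simp: words_def)
      then show "(prod_list (map R u) * D) powr s = prod_list (map R u) powr s * D powr s"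
        using \<open>0 \<le> D\<close> by (simp add: powr_mult)
    qed simp
    also have "(\<Sum>u\<in>words A n. prod_list (map R u) powr s) = \<theta> ^ n"
      unfolding \<theta>_def by (rule sum_words_powr) (use R in blast)
    also have "ennreal (\<theta> ^ n * D powr s) \<le> ennreal \<epsilon>" using n(2) by (intro ennreal_leI) simp
    finally show ?thesis .
  qed
  have "hausdorff_pre_measure s \<delta> E = 0" if "0 < \<delta>" for \<delta>
  proof -
    have "hausdorff_pre_measure s \<delta> E \<le> 0"
      by (rule ennreal_le_epsilon) (use pre[OF that] in auto)
    then show ?thesis by simp
  qed
  then show ?thesis unfolding hausdorff_measure_def by (simp add: SUP_eq_iff)
qed

text \<open>The sum \<open>\<Sum>i. R\<^sub>i\<^sup>s\<close> is strictly decreasing in \<open>s\<close>, so it is below \<open>1\<close> at every larger exponent,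
  where the measure vanishes. That \<open>s\<close> itself is nonnegative, as the exponents admitted in the
  definition of the dimension must be, follows because a negative power of a ratio exceeds \<open>1\<close>.\<close>

lemma hausdorff_dim_le_of_contractions:
  fixes E :: "'a::metric_space set" and T :: "'i \<Rightarrow> 'a \<Rightarrow> 'a"
  assumes "bounded E" and A: "finite A"
    and cover: "E \<subseteq> (\<Union>i\<in>A. T i ` E)"
    and inv: "\<And>i p. i \<in> A \<Longrightarrow> p \<in> E \<Longrightarrow> T i p \<in> E"
    and R: "\<And>i. i \<in> A \<Longrightarrow> 0 < R i \<and> R i < 1"
    and contract: "\<And>i p q. i \<in> A \<Longrightarrow> p \<in> E \<Longrightarrow> q \<in> E \<Longrightarrow> dist (T i p) (T i q) \<le> R i * dist p q"
    and sum1: "(\<Sum>i\<in>A. R i powr s) = 1"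
  shows "hausdorff_dim E \<le> ereal s"
proof (rule ereal_le_epsilon2)
  have "A \<noteq> {}" using sum1 by auto
  have "0 \<le> s"
  proof (rule ccontr)
    assume "\<not> 0 \<le> s"
    obtain i where "i \<in> A" using \<open>A \<noteq> {}\<close> by blast
    have "1 < R i powr s" using R[OF \<open>i \<in> A\<close>] \<open>\<not> 0 \<le> s\<close> by (simp add: powr_less_one powr_def mult_neg_neg)
    also have "\<dots> \<le> (\<Sum>i\<in>A. R i powr s)" by (rule member_le_sum) (use A \<open>i \<in> A\<close> in auto)
    finally show False using sum1 by simp
  qed
  fix e :: real assume "0 < e"
  have "(\<Sum>i\<in>A. R i powr (s + e)) < (\<Sum>i\<in>A. R i powr s)"
    by (rule sum_strict_mono) (use A \<open>A \<noteq> {}\<close> R \<open>0 < e\<close> in \<open>auto intro!: powr_less_mono'\<close>)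
  then have "hausdorff_measure (s + e) E = 0"
    using assms \<open>0 < e\<close> \<open>0 \<le> s\<close>
    by (intro hausdorff_measure_eq_0_of_contractions[where T = T and R = R and A = A]) auto
  then have "hausdorff_dim E \<le> ereal (s + e)"
    unfolding hausdorff_dim_def using \<open>0 \<le> s\<close> \<open>0 < e\<close> by (intro Inf_lower) auto
  then show "hausdorff_dim E \<le> ereal s + ereal e" by simp
qed

text \<open>The hypotheses on \<open>S\<close> and \<open>w\<close> are a strong open set condition, with \<open>S\<close> in the role of the open
  set: the pieces \<open>T i ` S\<close> are disjoint while the pieces \<open>T i ` E\<close> may touch, and some word moves all
  of \<open>E\<close> into \<open>S\<close>. If the measure vanished at an exponent \<open>t < s\<close>, the maps \<open>T\<^sub>u \<circ> T\<^sub>w\<close> for all words \<open>u\<close> of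
  one large length would be a separated system to which \<open>separated_cover_sum_ge\<close> applies.\<close>

lemma hausdorff_dim_ge_of_strong_separation:
  fixes E S :: "'a::metric_space set" and T :: "'i \<Rightarrow> 'a \<Rightarrow> 'a"
  assumes E: "compact E" "E \<noteq> {}" and A: "finite A" "2 \<le> card A"
    and inv: "\<And>i p. i \<in> A \<Longrightarrow> p \<in> E \<Longrightarrow> T i p \<in> E"
    and cont: "\<And>i. i \<in> A \<Longrightarrow> continuous_on E (T i)"
    and r: "\<And>i. i \<in> A \<Longrightarrow> 0 < r i \<and> r i < 1"
    and expand: "\<And>i p q. i \<in> A \<Longrightarrow> p \<in> E \<Longrightarrow> q \<in> E \<Longrightarrow> r i * dist p q \<le> dist (T i p) (T i q)"
    and S: "S \<subseteq> E" "\<And>i p. i \<in> A \<Longrightarrow> p \<in> S \<Longrightarrow> T i p \<in> S"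
    and disj: "\<And>i j. i \<in> A \<Longrightarrow> j \<in> A \<Longrightarrow> i \<noteq> j \<Longrightarrow> T i ` S \<inter> T j ` S = {}"
    and w: "set w \<subseteq> A" "foldr T w ` E \<subseteq> S"
    and sum1: "(\<Sum>i\<in>A. r i powr s) = 1"
  shows "ereal s \<le> hausdorff_dim E"
  unfolding hausdorff_dim_def
proof (rule Inf_greatest)
  fix y assume "y \<in> {ereal s |s. 0 \<le> s \<and> hausdorff_measure s E = 0}"
  then obtain t where t: "y = ereal t" "0 \<le> t" "hausdorff_measure t E = 0" by blast
  have "s \<le> t"
  proof (rule ccontr)
    assume "\<not> s \<le> t"
    have "A \<noteq> {}" using A by auto
    define \<theta> where "\<theta> = (\<Sum>i\<in>A. r i powr t)"
    define c where "c = prod_list (map r w)"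
    have "(\<Sum>i\<in>A. r i powr s) < \<theta>"
      unfolding \<theta>_def by (rule sum_strict_mono)
        (use A \<open>A \<noteq> {}\<close> r \<open>\<not> s \<le> t\<close> in \<open>auto intro!: powr_less_mono'\<close>)
    then have "1 < \<theta>" using sum1 by simp
    have "0 < c" unfolding c_def by (rule prod_list_map_pos) (use w r in blast)
    obtain n where n: "1 / c powr t < \<theta> ^ n" using real_arch_pow[OF \<open>1 < \<theta>\<close>] by blast
    \<comment> \<open>A positive length guarantees at least two words.\<close>
    define m where "m = Suc n"
    have "\<theta> ^ n \<le> \<theta> ^ m" unfolding m_def using \<open>1 < \<theta>\<close> by (intro power_increasing) auto
    then have "1 / c powr t \<le> \<theta> ^ m" using n by simp
    then have total: "1 \<le> \<theta> ^ m * c powr t" using \<open>0 < c\<close> by (simp add: field_simps)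
    define K where "K = words A m"
    define V where "V u = (\<lambda>p. foldr T u (foldr T w p))" for u
    define \<rho> where "\<rho> u = prod_list (map r u) * c" for u
    have KA: "set u \<subseteq> A" if "u \<in> K" for u using that by (simp add: K_def words_def)
    have rpos: "0 < prod_list (map r u)" if "u \<in> K" for u
      by (rule prod_list_map_pos) (use KA[OF that] r in blast)
    have "finite K" unfolding K_def by (rule finite_words[OF A(1)])
    have "card K = card A ^ m"
      unfolding K_def words_def by (rule card_lists_length_eq[OF A(1)])
    also have "\<dots> \<ge> card A ^ 1" unfolding m_def using A by (intro power_increasing) auto
    finally have "2 \<le> card K" using A by simp
    have wE: "foldr T w p \<in> E" if "p \<in> E" for p
      using w that S by blast
    have V_inv: "V u p \<in> E" if "u \<in> K" "p \<in> E" for u p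
      unfolding V_def by (rule foldr_maps_into) (use KA[OF that(1)] inv wE[OF that(2)] in auto)
    have inj: "inj_on (T i) S" if "i \<in> A" for i
    proof (rule inj_onI)
      fix p q assume "p \<in> S" "q \<in> S" "T i p = T i q"
      then have "r i * dist p q \<le> 0" using expand[OF that, of p q] S by auto
      then show "p = q" using r[OF that] by (simp add: mult_le_0_iff)
    qed
    have VC: "compact (V u ` E)" if "u \<in> K" for u
    proof (rule compact_continuous_image[OF _ E(1)])
      show "continuous_on E (V u)" unfolding V_def
        by (rule continuous_on_compose2[of E "foldr T u"])
           (use KA[OF that] w inv cont wE in \<open>auto intro!: foldr_continuous_on\<close>)
    qed
    have Vdisj: "V u ` E \<inter> V v ` E = {}" if "u \<in> K" "v \<in> K" "u \<noteq> v" for u v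
    proof (rule ccontr)
      assume "V u ` E \<inter> V v ` E \<noteq> {}"
      then obtain p q where "p \<in> E" "q \<in> E" "V u p = V v q" by blast
      then have "u = v"
        using that w(2) unfolding K_def V_def
        by (intro words_images_disjoint[where T = T and A = A and S = S and n = m
              and p = "foldr T w p" and q = "foldr T w q"]) (use S disj inj in auto)
      then show False using that by simp
    qed
    obtain \<delta> where \<delta>: "0 < \<delta>"
      "\<And>k l p q. k \<in> K \<Longrightarrow> l \<in> K \<Longrightarrow> k \<noteq> l \<Longrightarrow> p \<in> V k ` E \<Longrightarrow> q \<in> V l ` E \<Longrightarrow> \<delta> \<le> dist p q"
      using disjoint_compacts_gap[of K "\<lambda>u. V u ` E"] \<open>finite K\<close> VC Vdisj by metis
    have Vexp: "\<rho> u * dist p q \<le> dist (V u p) (V u q)" if "u \<in> K" "p \<in> E" "q \<in> E" for u p q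
    proof -
      have "\<rho> u * dist p q = prod_list (map r u) * (c * dist p q)" by (simp add: \<rho>_def)
      also have "\<dots> \<le> prod_list (map r u) * dist (foldr T w p) (foldr T w q)"
        unfolding c_def using rpos[OF that(1)] w r inv expand that
        by (intro mult_left_mono foldr_dist_ge[where E = E]) auto
      also have "\<dots> \<le> dist (V u p) (V u q)"
        unfolding V_def by (rule foldr_dist_ge[where E = E]) (use KA[OF that(1)] r inv expand that wE in auto)
      finally show ?thesis .
    qed
    have "(\<Sum>u\<in>K. \<rho> u powr t) = (\<Sum>u\<in>K. prod_list (map r u) powr t) * c powr t"
      unfolding sum_distrib_right \<rho>_def
      by (rule sum.cong) (use rpos \<open>0 < c\<close> in \<open>auto simp: powr_mult less_imp_le\<close>)
    also have "\<dots> = \<theta> ^ m * c powr t"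
      unfolding K_def \<theta>_def by (subst sum_words_powr) (use r in auto)
    finally have tot: "1 \<le> (\<Sum>u\<in>K. \<rho> u powr t)" using total by simp
    obtain I :: "nat set" and U where IU: "finite I" "E \<subseteq> (\<Union>i\<in>I. U i)"
      "\<And>i. i \<in> I \<Longrightarrow> bounded (U i)" "(\<Sum>i\<in>I. diameter (U i) powr t) < \<delta> powr t"
      using finite_covers_of_null_compact[OF E(1) t(2,3), of "\<delta> powr t"] \<delta>(1) by auto
    have "\<delta> powr t \<le> (\<Sum>i\<in>I. diameter (U i) powr t)"
      by (rule separated_cover_sum_ge[where K = K and V = V and \<rho> = \<rho> and E = E])
         (use \<open>finite K\<close> \<open>2 \<le> card K\<close> E t \<delta> V_inv Vexp tot IU rpos \<open>0 < c\<close> in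
           \<open>auto simp: \<rho>_def\<close>)
    then show False using IU(4) by simp
  qed
  then show "ereal s \<le> y" using t by simp
qed

section \<open>The graph of the fractal function\<close>

lemma L_map_strict_mono:
  assumes "x 1 < x N" and "x j < x (j + 1)" and "t < u"
  shows "L_map N x j t < L_map N x j u"
  using assms by (simp add: L_map_def divide_strict_right_mono mult_strict_left_mono)

lemma L_map_mono:
  assumes "x 1 < x N" and "x j < x (j + 1)" and "t \<le> u"
  shows "L_map N x j t \<le> L_map N x j u"
  using L_map_strict_mono[of x N j t u] assms by (cases "t = u") auto

lemma L_map_surj:
  assumes "x 1 < x N" and "x j < x (j + 1)" and "v \<in> {x j..x (j + 1)}"
  shows "\<exists>t\<in>{x 1..x N}. L_map N x j t = v"
proof -
  have "continuous_on {x 1..x N} (L_map N x j)"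
    unfolding L_map_def by (intro continuous_intros)
  then show ?thesis
    using IVT'[of "L_map N x j" "x 1" v "x N"] assms L_map_endpoints[of x N j] by auto
qed

text \<open>The functional equation at \<open>L\<^sub>j(t)\<close>, where the inverse in it evaluates to \<open>t\<close>, is exactly
  the statement that \<open>W\<^sub>j\<close> maps the graph into itself over \<open>L\<^sub>j\<close>.\<close>

lemma W_map_fractal_graph:
  assumes "is_fractal_function N x f b \<alpha> g" and "x 1 < x N" and "j \<in> {1..<N}" and "x j < x (j + 1)"
    and "t \<in> {x 1..x N}"
  shows "W_map N x f b \<alpha> j (t, g t) = (L_map N x j t, g (L_map N x j t))"
proof -
  have inj: "inj_on (L_map N x j) {x 1..x N}"
    using L_map_strict_mono[OF assms(2,4)] by (intro strict_mono_on_imp_inj_on strict_mono_onI) auto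
  have "L_map N x j t \<in> {x j..x (j + 1)}"
    using L_map_mono[OF assms(2,4), of "x 1" t] L_map_mono[OF assms(2,4), of t "x N"]
      L_map_endpoints[OF assms(2), of j] assms(5) by auto
  then have "g (L_map N x j t) = f (L_map N x j t) + \<alpha> j t * (g t - b t)"
    using assms(1,3) inv_into_f_f[OF inj assms(5)] unfolding is_fractal_function_def Let_def by metis
  then show ?thesis by (simp add: W_map_def algebra_simps)
qed

theorem theorem2p4:
  fixes N :: nat and x :: "nat \<Rightarrow> real" and f b f\<alpha> :: "real \<Rightarrow> real"
    and \<alpha> :: "nat \<Rightarrow> real \<Rightarrow> real" and r R :: "nat \<Rightarrow> real" and s_lower s_upper :: real
  assumes "fractal_data N x f b \<alpha>"
    and "is_fractal_function N x f b \<alpha> f\<alpha>"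
    and "\<forall>i\<in>{1..<N}. 0 < r i \<and> r i \<le> R i \<and> R i < 1"
    and "\<forall>i\<in>{1..<N}. \<forall>p\<in>{x 1..x N} \<times> UNIV. \<forall>q\<in>{x 1..x N} \<times> UNIV.
           r i * norm (p - q) \<le> norm (W_map N x f b \<alpha> i p - W_map N x f b \<alpha> i q) \<and>
           norm (W_map N x f b \<alpha> i p - W_map N x f b \<alpha> i q) \<le> R i * norm (p - q)"
    and "(\<Sum>i\<in>{1..<N}. r i powr s_lower) = 1"
    and "(\<Sum>i\<in>{1..<N}. R i powr s_upper) = 1"
  shows "ereal s_lower \<le> hausdorff_dim (graph_on {x 1..x N} f\<alpha>) \<and>
         hausdorff_dim (graph_on {x 1..x N} f\<alpha>) \<le> ereal s_upper"
proof -
  define T where "T = W_map N x f b \<alpha>"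
  define L where "L = L_map N x"
  define A where "A = {1..<N}"
  define E where "E = graph_on {x 1..x N} f\<alpha>"
  define S where "S = graph_on {x 1<..<x N} f\<alpha>"
  have N: "2 \<le> N" and mono: "strict_mono_on {1..N} x"
    using assms(1) by (auto simp: fractal_data_def)
  have xN: "x 1 < x N" using N by (intro strict_mono_onD[OF mono]) auto
  have xmono: "x i \<le> x j" if "1 \<le> i" "i \<le> j" "j \<le> N" for i j
    using strict_mono_onD[OF mono, of i j] that by (cases "i = j") auto
  have step: "x j < x (j + 1)" if "j \<in> A" for j
    using that by (intro strict_mono_onD[OF mono]) (auto simp: A_def)
  have ends: "L j (x 1) = x j" "L j (x N) = x (j + 1)" for j
    using L_map_endpoints[OF xN] by (auto simp: L_def)
  have Lmono: "L j t < L j u" if "j \<in> A" "t < u" for j t u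
    unfolding L_def by (rule L_map_strict_mono[OF xN step[OF that(1)] that(2)])
  have Lle: "L j t \<le> L j u" if "j \<in> A" "t \<le> u" for j t u
    unfolding L_def by (rule L_map_mono[OF xN step[OF that(1)] that(2)])
  have L_Icc: "L j t \<in> {x j..x (j + 1)}" if "j \<in> A" "t \<in> {x 1..x N}" for j t
    using Lle[OF that(1), of "x 1" t] Lle[OF that(1), of t "x N"] that(2) ends[of j] by auto
  have L_Ioo: "L j t \<in> {x j<..<x (j + 1)}" if "j \<in> A" "t \<in> {x 1<..<x N}" for j t
    using Lmono[OF that(1), of "x 1" t] Lmono[OF that(1), of t "x N"] that(2) ends[of j] by auto
  have xA: "x 1 \<le> x j" "x (j + 1) \<le> x N" if "j \<in> A" for j
    using that by (auto simp: A_def intro!: xmono)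
  have TL: "T j (t, f\<alpha> t) = (L j t, f\<alpha> (L j t))" if "j \<in> A" "t \<in> {x 1..x N}" for j t
    unfolding T_def L_def
    by (rule W_map_fractal_graph[OF assms(2) xN _ step]) (use that in \<open>auto simp: A_def\<close>)
  have E_sub: "E \<subseteq> {x 1..x N} \<times> UNIV" by (auto simp: E_def graph_on_def)
  have bounds: "r i * dist p q \<le> dist (T i p) (T i q)" "dist (T i p) (T i q) \<le> R i * dist p q"
    if "i \<in> A" "p \<in> {x 1..x N} \<times> UNIV" "q \<in> {x 1..x N} \<times> UNIV" for i p q
    using assms(4) that unfolding T_def A_def dist_norm by blast+
  have bounds_E: "r i * dist p q \<le> dist (T i p) (T i q)" "dist (T i p) (T i q) \<le> R i * dist p q"
    if "i \<in> A" "p \<in> E" "q \<in> E" for i p q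
    using bounds[OF that(1)] E_sub that(2,3) by blast+
  have rR: "0 < r i" "0 < R i" "r i < 1" "R i < 1" if "i \<in> A" for i
    proof -
    have "0 < r i \<and> r i \<le> R i \<and> R i < 1" using assms(3) that by (simp add: A_def)
    then show "0 < r i" "0 < R i" "r i < 1" "R i < 1" by linarith+
  qed
  have inv: "T i p \<in> E" if "i \<in> A" "p \<in> E" for i p
  proof -
    obtain t where "t \<in> {x 1..x N}" "p = (t, f\<alpha> t)" using \<open>p \<in> E\<close> by (auto simp: E_def graph_on_def)
    then show ?thesis using TL[OF that(1)] L_Icc[OF that(1)] xA[OF that(1)]
      by (fastforce simp: E_def graph_on_def)
  qed
  have invS: "T i p \<in> S \<and> fst (T i p) \<in> {x i<..<x (i + 1)}" if "i \<in> A" "p \<in> S" for i p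
  proof -
    obtain t where t: "t \<in> {x 1<..<x N}" "p = (t, f\<alpha> t)" using \<open>p \<in> S\<close> by (auto simp: S_def graph_on_def)
    then have "T i p = (L i t, f\<alpha> (L i t))" using TL[OF that(1), of t] by auto
    then show ?thesis using L_Ioo[OF that(1) t(1)] xA[OF that(1)]
      by (auto simp: S_def graph_on_def)
  qed
  have "E = (\<lambda>t. (t, f\<alpha> t)) ` {x 1..x N}" by (auto simp: E_def graph_on_def)
  moreover have "continuous_on {x 1..x N} (\<lambda>t. (t, f\<alpha> t))"
    using assms(2) by (intro continuous_intros) (auto simp: is_fractal_function_def)
  ultimately have "compact E" using compact_continuous_image by blast
  have "E \<noteq> {}" using xN by (auto simp: E_def graph_on_def)
  have cover: "E \<subseteq> (\<Union>i\<in>A. T i ` E)"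
  proof
    fix p assume "p \<in> E"
    then obtain v where v: "v \<in> {x 1..x N}" "p = (v, f\<alpha> v)" by (auto simp: E_def graph_on_def)
    have "\<exists>j\<in>A. v \<in> {x j..x (j + 1)}"
    proof (rule ccontr)
      assume no: "\<not> ?thesis"
      \<comment> \<open>A point in no subinterval would lie to the right of every node.\<close>
      have ge: "x (Suc n) \<le> v" if "Suc n \<le> N" for n
        using that
      proof (induction n)
        case (Suc n)
        then show ?case using no by (force simp: A_def)
      qed (use v in simp)
      then have "x (N - 1) \<le> v" using N ge[of "N - 2"] by (simp add: numeral_2_eq_2 Suc_diff_Suc)
      then show False using no v N by (auto simp: A_def dest!: bspec[of _ _ "N - 1"])
    qed
    then obtain j where j: "j \<in> A" "v \<in> {x j..x (j + 1)}" by blast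
    obtain t where t: "t \<in> {x 1..x N}" "L j t = v"
      using L_map_surj[OF xN step[OF j(1)] j(2)] by (auto simp: L_def)
    then have "p = T j (t, f\<alpha> t)" using TL[OF j(1) t(1)] v by simp
    moreover have "(t, f\<alpha> t) \<in> E" using t by (auto simp: E_def graph_on_def)
    ultimately show "p \<in> (\<Union>i\<in>A. T i ` E)" using j by blast
  qed
  have upper: "hausdorff_dim E \<le> ereal s_upper"
    by (rule hausdorff_dim_le_of_contractions[where A = A and T = T and R = R])
       (use \<open>compact E\<close> compact_imp_bounded cover inv rR bounds_E assms(6) in \<open>auto simp: A_def\<close>)
  \<comment> \<open>For a single subinterval the map fixes first coordinates, so it does not contract.\<close>
  have "N \<noteq> 2"
  proof
    assume "N = 2"
    then have "1 \<in> A" by (simp add: A_def)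
    have "dist (x 1) (x N) = dist (L 1 (x 1)) (L 1 (x N))"
      using ends[of 1] \<open>N = 2\<close> by (simp add: numeral_2_eq_2)
    also have "\<dots> = dist (fst (T 1 (x 1, 0))) (fst (T 1 (x N, 0)))"
      by (simp add: T_def W_map_def L_def)
    also have "\<dots> \<le> dist (T 1 (x 1, 0)) (T 1 (x N, 0))" by (rule dist_fst_le)
    also have "\<dots> \<le> R 1 * dist (x 1, 0::real) (x N, 0)"
      using xN by (intro bounds[OF \<open>1 \<in> A\<close>]) auto
    also have "\<dots> = R 1 * dist (x 1) (x N)" by (simp add: dist_Pair_Pair)
    also have "\<dots> < 1 * dist (x 1) (x N)"
      using rR(4)[OF \<open>1 \<in> A\<close>] xN by (intro mult_strict_right_mono) auto
    finally show False by simp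
  qed
  then have N3: "3 \<le> N" using N by simp
  then have A12: "1 \<in> A" "2 \<in> A" by (auto simp: A_def)
  \<comment> \<open>The word [1, 2] moves the interval into the part of the first subinterval to the right of its
      left endpoint, and the right endpoint of that subinterval is interior as there are at least
      two subintervals.\<close>
  have lower: "ereal s_lower \<le> hausdorff_dim E"
  proof (rule hausdorff_dim_ge_of_strong_separation[where A = A and T = T and r = r and S = S and w = "[1, 2]"])
    show "S \<subseteq> E" by (auto simp: S_def E_def graph_on_def)
    show "continuous_on E (T i)" if "i \<in> A" for i
    proof (rule continuous_on_subset[OF _ E_sub], rule lipschitz_on_continuous_on[of "R i"])
      show "(R i)-lipschitz_on ({x 1..x N} \<times> UNIV) (T i)"
        by (rule lipschitz_onI) (use bounds(2)[OF that] rR[OF that] in auto)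
    qed
    show "T i ` S \<inter> T j ` S = {}" if "i \<in> A" "j \<in> A" "i \<noteq> j" for i j
    proof -
      have *: "x (i + 1) \<le> x j \<or> x (j + 1) \<le> x i"
        using that by (cases "i < j") (auto simp: A_def intro!: xmono)
      show ?thesis using invS[OF that(1)] invS[OF that(2)] * by fastforce
    qed
    show "foldr T [1, 2] ` E \<subseteq> S"
    proof
      fix p assume "p \<in> foldr T [1, 2] ` E"
      then obtain t where t: "t \<in> {x 1..x N}" "p = T 1 (T 2 (t, f\<alpha> t))"
        by (auto simp: E_def graph_on_def)
      have L2: "L 2 t \<in> {x 2..x (2 + 1)}" by (rule L_Icc[OF A12(2) t(1)])
      have "x 1 < x 2" "x 2 < x N" using N3 by (auto intro!: strict_mono_onD[OF mono])
      moreover have "x (2 + 1) \<le> x N" using xA[OF A12(2)] by simp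
      ultimately have L2': "L 2 t \<in> {x 1..x N}" "x 1 < L 2 t" using L2 by auto
      have "p = (L 1 (L 2 t), f\<alpha> (L 1 (L 2 t)))"
        using t TL[OF A12(2) t(1)] TL[OF A12(1) L2'(1)] by simp
      moreover have "x 1 < L 1 (L 2 t)" using Lmono[OF A12(1) L2'(2)] ends(1)[of 1] by simp
      moreover have "L 1 (L 2 t) < x N"
        using L_Icc[OF A12(1) L2'(1)] \<open>x 2 < x N\<close> by (simp add: numeral_2_eq_2)
      ultimately show "p \<in> S" by (auto simp: S_def graph_on_def)
    qed
    show "2 \<le> card A" using N3 by (simp add: A_def)
  qed (use \<open>compact E\<close> \<open>E \<noteq> {}\<close> inv rR bounds_E invS A12 assms(5) in \<open>auto simp: A_def\<close>)
  show ?thesis using lower upper by (simp add: E_def)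
qed

end
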